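(* Let $d \ge 1$ be fixed, let $S$ be a set of $n$ points in $\mathbb{R}^d$, and let $w : S \to \mathbb{R}_{\ge 0}$ be a weight function. For every fixed constant $\epsilon > 0$ and every integer $k \ge 1$, there exists a $(k, 4+\epsilon)$-vertex fault-tolerant additive weighted spanner (VFTAWS) for the metric space $(S, d_w)$ having $O(kn)$ edges, where the constant hidden in the $O$-notation depends only on $d$ and $\epsilon$.
   Context: For a weighted point set $(S,w)$ the additive weighted distance is $d_w(p,q) = 0$ if $p = q$ and $d_w(p,q) = w(p) + |pq| + w(q)$ if $p \neq q$, where $|pq|$ is the Euclidean distance. A graph $G$ with vertex set $S$ is viewed as edge-weighted, the weight of an edge $(p,q)$ being $d_w(p,q)$; $d_G(p,q)$ denotes the minimum total weight of a path between $p$ and $q$ in $G$. For $t > 1$, $G$ is a $t$-spanner for $(S,d_w)$ if $d_G(p,q) \le t \cdot d_w(p,q)$ for all $p, q \in S$. For an integer $k \ge 1$, $G$ is a $(k,t)$-VFTAWS for $(S,d_w)$ if for every subset $S' \subset S$ with $|S'| \le k$, the graph $G \setminus S'$ (delete the vertices of $S'$ and their incident edges) is a $t$-spanner for $S \setminus S'$ with respect to $d_w$, i.e. $d_{G \setminus S'}(p,q) \le t\cdot d_w(p,q)$ for all $p,q \in S\setminus S'$. *)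

theory Defs
  imports "HOL-Analysis.Analysis"
begin

definition dw :: "('a::euclidean_space \<Rightarrow> real) \<Rightarrow> 'a \<Rightarrow> 'a \<Rightarrow> real" where
  "dw w p q = (if p = q then 0 else w p + dist p q + w q)"

definition is_walk :: "'a set set \<Rightarrow> 'a set \<Rightarrow> 'a list \<Rightarrow> bool" where
  "is_walk E V xs \<longleftrightarrow> xs \<noteq> [] \<and> set xs \<subseteq> V \<and>
     (\<forall>i < length xs - 1. {xs ! i, xs ! Suc i} \<in> E)"

definition walk_weight :: "('a::euclidean_space \<Rightarrow> real) \<Rightarrow> 'a list \<Rightarrow> real" where
  "walk_weight w xs = (\<Sum>i<length xs - 1. dw w (xs ! i) (xs ! Suc i))"

text \<open>The graph (V,E) (edges restricted to V) is a t-spanner for (V, dw):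
  d_G(p,q) \<le> t * dw(p,q) for all p,q in V.\<close>
definition is_spanner :: "('a::euclidean_space \<Rightarrow> real) \<Rightarrow> 'a set set \<Rightarrow> 'a set \<Rightarrow> real \<Rightarrow> bool" where
  "is_spanner w E V t \<longleftrightarrow> (\<forall>p\<in>V. \<forall>q\<in>V. \<exists>xs. is_walk E V xs \<and> hd xs = p \<and> last xs = q \<and>
       walk_weight w xs \<le> t * dw w p q)"

definition is_VFTAWS :: "('a::euclidean_space \<Rightarrow> real) \<Rightarrow> 'a set \<Rightarrow> 'a set set \<Rightarrow> nat \<Rightarrow> real \<Rightarrow> bool" where
  "is_VFTAWS w S E k t \<longleftrightarrow>
     E \<subseteq> {{p, q} | p q. p \<in> S \<and> q \<in> S \<and> p \<noteq> q} \<and>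
     (\<forall>S'. S' \<subseteq> S \<and> card S' \<le> k \<and> finite S' \<longrightarrow> is_spanner w E (S - S') t)"

end

theory Submission
  imports Defs
begin

text \<open>
  Stretch 4 already suffices. Call \<open>q\<close> light for \<open>p\<close> if \<open>5 w(q) \<le> 3 w(p) + |pq|\<close>. In every cone of a
  Yao graph each \<open>p\<close> is joined to its \<open>k + 1\<close> nearest light points. If \<open>q\<close> is light for \<open>p\<close>, then either
  \<open>pq\<close> is an edge, or each of the chosen points \<open>r\<close> of the cone of \<open>q\<close> satisfies
  \<open>d\<^sub>w(p,r) + 4 d\<^sub>w(r,q) \<le> 4 d\<^sub>w(p,q)\<close>; some \<open>r\<close> survives the faults, and one continues from \<open>r\<close>.

  If neither point is light for the other, their weights are comparable and \<open>|pq|\<close> is bounded by a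
  multiple of these weights. Such pairs are served by hubs: a maximal set \<open>H\<close> of points of positive
  weight without \<open>k + 2\<close> members that pairwise are close and of similar weight, relative to their
  weights. By compactness \<open>O(k)\<close> hubs are comparable to a given point, which is joined to all of them,
  and by maximality a point outside \<open>H\<close> has \<open>k + 1\<close> hubs next to it, each giving a path of two edges.
\<close>

section \<open>Finite partitions, counting, and choice of nearest elements\<close>

lemma dw_commute: "dw w p q = dw w q p"
  by (simp add: dw_def dist_commute)

text \<open>Total boundedness covers \<open>K\<close> by finitely many balls of radius
  \<open>e / 2\<close>; \<open>f\<close> sends each point of \<open>K\<close> to the centre of a
  ball containing it. It is used for cones of directions and for rescaled positions and weights of
  hubs.\<close>

lemma compact_finite_classes:
  fixes K :: "'b::metric_space set"
  assumes "compact K" "e > 0"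
  obtains f :: "'b \<Rightarrow> 'b" and C where "finite C" "\<And>x. x \<in> K \<Longrightarrow> f x \<in> C"
    "\<And>x y. x \<in> K \<Longrightarrow> y \<in> K \<Longrightarrow> f x = f y \<Longrightarrow> dist x y < e"
proof -
  have "e / 2 > 0" using assms by simp
  then obtain C where C: "finite C" "K \<subseteq> (\<Union>c\<in>C. ball c (e / 2))"
    using assms(1) unfolding compact_eq_totally_bounded by meson
  then have "\<forall>x\<in>K. \<exists>c. c \<in> C \<and> dist c x < e / 2"
    unfolding subset_iff UN_iff mem_ball by blast
  then obtain f where f: "\<And>x. x \<in> K \<Longrightarrow> f x \<in> C \<and> dist (f x) x < e / 2" by metis
  show ?thesis
  proof (rule that[of C f])
    fix x y assume "x \<in> K" "y \<in> K" "f x = f y"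
    then show "dist x y < e"
      using f[of x] f[of y] dist_triangle_half_r[of "f x" x e y] by metis
  qed (use C f in auto)
qed

lemma card_UN_bounded:
  assumes "finite C" "\<And>c. c \<in> C \<Longrightarrow> card (A c) \<le> n"
  shows "card (\<Union>c\<in>C. A c) \<le> card C * n"
proof -
  have "card (\<Union>c\<in>C. A c) \<le> (\<Sum>c\<in>C. card (A c))" by (rule card_UN_le[OF assms(1)])
  also have "\<dots> \<le> card C * n"
    using sum_bounded_above[of C "\<lambda>c. card (A c)" n] assms(2) by simp
  finally show ?thesis .
qed

lemma card_le_by_classes:
  assumes "finite C" "\<And>x. x \<in> A \<Longrightarrow> f x \<in> C" "\<And>c. c \<in> C \<Longrightarrow> card {x\<in>A. f x = c} \<le> n"
  shows "card A \<le> card C * n"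
proof -
  have "A = (\<Union>c\<in>C. {x\<in>A. f x = c})" using assms(2) by auto
  then show ?thesis using card_UN_bounded[of C "\<lambda>c. {x\<in>A. f x = c}" n] assms by simp
qed

text \<open>Greedy choice: each new element minimizes \<open>g\<close> among those left. The
  equation \<open>card B = n\<close> stands under the quantifier over \<open>A - B\<close> because
  \<open>B\<close> must be full only if something is left out; a set with fewer than
  \<open>n\<close> elements is taken whole.\<close>

lemma ex_smallest_subset:
  fixes g :: "'b \<Rightarrow> real"
  assumes "finite A"
  shows "\<exists>B\<subseteq>A. card B \<le> n \<and> (\<forall>a\<in>A-B. card B = n \<and> (\<forall>b\<in>B. g b \<le> g a))"
proof (induction n)
  case 0
  then show ?case by (intro exI[of _ "{}"]) auto
next
  case (Suc n)
  then obtain B where B: "B \<subseteq> A" "card B \<le> n"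
    "\<forall>a\<in>A-B. card B = n \<and> (\<forall>b\<in>B. g b \<le> g a)" by blast
  show ?case
  proof (cases "A - B = {}")
    case True
    then show ?thesis using B by (intro exI[of _ B]) auto
  next
    case False
    have fin: "finite (A - B)" "finite B" using assms B finite_subset by auto
    obtain x where x: "x \<in> A - B" "\<And>y. y \<in> A - B \<Longrightarrow> g x \<le> g y"
      using ex_is_arg_min_if_finite[OF fin(1) False, of g]
      unfolding is_arg_min_linorder by blast
    then have "card (insert x B) = Suc n" using B fin by simp
    then show ?thesis using x B by (intro exI[of _ "insert x B"]) auto
  qed
qed

section \<open>Light pairs: neighbours in cones\<close>

lemma cone_dist_le:
  fixes p q r :: "'a::real_normed_vector"
  assumes "p \<noteq> q" "p \<noteq> r" "dist p r \<le> dist p q" "dist (sgn (r - p)) (sgn (q - p)) \<le> 1/2"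
  shows "dist r q \<le> dist p q - dist p r / 2"
proof -
  define a b u v where "a = dist p r" and "b = dist p q" and "u = sgn (r - p)" and "v = sgn (q - p)"
  have ru: "r - p = a *\<^sub>R u" and qv: "q - p = b *\<^sub>R v"
    using assms(1,2) by (simp_all add: a_def b_def u_def v_def sgn_div_norm dist_norm norm_minus_commute)
  \<comment> \<open>Going the length \<open>a\<close> along \<open>v\<close> instead of
    \<open>u\<close> moves the end point by \<open>a *\<^sub>R (v - u)\<close>, of norm at most
    \<open>a / 2\<close>; from there the length \<open>b - a\<close> along \<open>v\<close>
    remains.\<close>
  have "q - r = (q - p) - (r - p)" by simp
  also have "\<dots> = (b - a) *\<^sub>R v + a *\<^sub>R (v - u)" by (simp add: ru qv algebra_simps)
  finally have "norm (q - r) \<le> norm ((b - a) *\<^sub>R v) + norm (a *\<^sub>R (v - u))"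
    by (metis norm_triangle_ineq)
  also have "\<dots> = (b - a) + a * norm (v - u)"
    using assms(1,3) by (simp add: a_def b_def v_def norm_sgn)
  also have "\<dots> \<le> (b - a) + a * (1/2)"
    using assms(4) by (intro add_left_mono mult_left_mono)
      (auto simp: a_def u_def v_def dist_norm norm_minus_commute)
  finally show ?thesis by (simp add: a_def b_def dist_norm norm_minus_commute)
qed

text \<open>The coefficients 5 and 3 come from stretch 4: in \<open>dw w p r + 4 * dw w r q\<close>
  the weight of \<open>r\<close> occurs 1 + 4 times and that of \<open>p\<close> once, so 4 - 1
  copies of \<open>w p\<close> are left to pay for \<open>r\<close>. The size \<open>k + 1\<close>
  lets some element of \<open>B\<close> survive \<open>k\<close> faults.\<close>

definition light_neighbours :: "('a::euclidean_space \<Rightarrow> real) \<Rightarrow> 'a set \<Rightarrow> nat \<Rightarrow> nat \<Rightarrow> ('a \<Rightarrow> 'a set) \<Rightarrow> bool" where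
  "light_neighbours w S k m T \<longleftrightarrow>
    (\<forall>p\<in>S. T p \<subseteq> S - {p} \<and> card (T p) \<le> m * (k + 1)) \<and>
    (\<forall>p\<in>S. \<forall>q\<in>S. p \<noteq> q \<longrightarrow> 5 * w q \<le> 3 * w p + dist p q \<longrightarrow> q \<notin> T p \<longrightarrow>
        (\<exists>B\<subseteq>T p. card B = k + 1 \<and> (\<forall>r\<in>B. dw w p r + 4 * dw w r q \<le> 4 * dw w p q)))"

text \<open>Membership in either direction gives an edge, the graph being undirected. Otherwise all
  of \<open>B\<close> is joined to both ends, so each survivor is the middle of a path of two
  edges.\<close>

definition heavy_neighbours :: "('a::euclidean_space \<Rightarrow> real) \<Rightarrow> 'a set \<Rightarrow> nat \<Rightarrow> nat \<Rightarrow> ('a \<Rightarrow> 'a set) \<Rightarrow> bool" where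
  "heavy_neighbours w S k m T \<longleftrightarrow>
    (\<forall>p\<in>S. T p \<subseteq> S - {p} \<and> card (T p) \<le> m * (k + 1)) \<and>
    (\<forall>p\<in>S. \<forall>q\<in>S. p \<noteq> q \<longrightarrow> 5 * w q > 3 * w p + dist p q \<longrightarrow> 5 * w p > 3 * w q + dist p q \<longrightarrow>
        q \<in> T p \<or> p \<in> T q \<or>
        (\<exists>B\<subseteq>T p \<inter> T q. card B = k + 1 \<and> (\<forall>h\<in>B. dw w p h + dw w h q \<le> 4 * dw w p q)))"

text \<open>The number \<open>m\<close> counts cones, that is, classes of unit vectors of diameter
  below 1/2. They are fixed before \<open>k\<close>, \<open>S\<close> and \<open>w\<close>, so
  \<open>m\<close> depends only on the space.\<close>

lemma ex_light_neighbours: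
  "\<exists>m::nat. \<forall>(k::nat) (S::'a::euclidean_space set) w. finite S \<longrightarrow> (\<exists>T. light_neighbours w S k m T)"
proof -
  have "compact (sphere (0::'a) 1)" "(1/2::real) > 0" by simp_all
  then obtain f :: "'a \<Rightarrow> 'a" and C where C: "finite C" "\<And>x. x \<in> sphere 0 1 \<Longrightarrow> f x \<in> C"
    "\<And>x y. x \<in> sphere 0 1 \<Longrightarrow> y \<in> sphere 0 1 \<Longrightarrow> f x = f y \<Longrightarrow> dist x y < 1/2"
    by (rule compact_finite_classes) blast
  show ?thesis
  proof (intro exI[of _ "card C"] allI impI)
    fix k :: nat and S :: "'a set" and w :: "'a \<Rightarrow> real"
    assume fin: "finite S"
    \<comment> \<open>\<open>G p c\<close> holds the light points for \<open>p\<close> in the cone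
      \<open>c\<close>; \<open>N p c\<close> below consists of the \<open>k + 1\<close> nearest of
      them to \<open>p\<close>, or of all if there are fewer.\<close>
    define G where "G p c =
      {r\<in>S. r \<noteq> p \<and> 5 * w r \<le> 3 * w p + dist p r \<and> f (sgn (r - p)) = c}" for p c
    have "\<exists>B\<subseteq>G p c. card B \<le> k + 1 \<and>
        (\<forall>a\<in>G p c - B. card B = k + 1 \<and> (\<forall>b\<in>B. dist p b \<le> dist p a))" for p c
      using fin by (intro ex_smallest_subset) (simp add: G_def)
    then obtain N where N: "\<And>p c. N p c \<subseteq> G p c" "\<And>p c. card (N p c) \<le> k + 1"
      "\<And>p c a. a \<in> G p c - N p c \<Longrightarrow> card (N p c) = k + 1 \<and> (\<forall>b\<in>N p c. dist p b \<le> dist p a)"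
      by metis
    define T where "T p = (\<Union>c\<in>C. N p c)" for p
    have sub: "T p \<subseteq> S - {p}" for p using N(1) by (fastforce simp: T_def G_def)
    have card: "card (T p) \<le> card C * (k + 1)" for p
      unfolding T_def by (intro card_UN_bounded C(1) N(2))
    have "\<exists>B\<subseteq>T p. card B = k + 1 \<and> (\<forall>r\<in>B. dw w p r + 4 * dw w r q \<le> 4 * dw w p q)"
      if pq: "p \<in> S" "q \<in> S" "p \<noteq> q" "5 * w q \<le> 3 * w p + dist p q" "q \<notin> T p" for p q
    proof -
      define c where "c = f (sgn (q - p))"
      have unit: "sgn (x - p) \<in> sphere 0 1" if "x \<noteq> p" for x using that by (simp add: norm_sgn)
      have c: "c \<in> C" unfolding c_def using C(2)[OF unit[of q]] pq by auto
      have q: "q \<in> G p c - N p c" using pq c by (auto simp: G_def c_def T_def)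
      show ?thesis
      proof (intro exI[of _ "N p c"] conjI ballI)
        show "N p c \<subseteq> T p" using c by (auto simp: T_def)
        show "card (N p c) = k + 1" using N(3)[OF q] by simp
        fix r assume r: "r \<in> N p c"
        then have rG: "r \<in> G p c" and "r \<noteq> q" using N(1) q by auto
        have "dist (sgn (r - p)) (sgn (q - p)) < 1/2"
          using rG pq unit by (intro C(3)) (auto simp: G_def c_def)
        moreover have "dist p r \<le> dist p q" using N(3)[OF q] r by blast
        ultimately have "dist r q \<le> dist p q - dist p r / 2"
          using rG pq by (intro cone_dist_le) (auto simp: G_def)
        \<comment> \<open>The cone bound saves \<open>2 * dist p r\<close> in
          \<open>4 * dist r q\<close>. One half pays for the edge from \<open>p\<close> to
          \<open>r\<close>, the other for the term \<open>dist p r\<close> in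
          \<open>5 * w r \<le> 3 * w p + dist p r\<close>.\<close>
        then show "dw w p r + 4 * dw w r q \<le> 4 * dw w p q"
          using rG pq \<open>r \<noteq> q\<close> by (auto simp: dw_def G_def)
      qed
    qed
    then show "\<exists>T. light_neighbours w S k (card C) T"
      using sub card unfolding light_neighbours_def by (intro exI[of _ T]) simp
  qed
qed

section \<open>Heavy pairs: sparse sets of hubs\<close>

definition near :: "('a::metric_space \<Rightarrow> real) \<Rightarrow> 'a \<Rightarrow> 'a \<Rightarrow> bool" where
  "near w a b \<longleftrightarrow> dist a b \<le> w b / 4 \<and> w a \<le> 5/4 * w b"

text \<open>A bound on the size of cliques. Since \<open>near\<close> measures relative to its
  second argument and is not symmetric, the ordered pairs \<open>a\<close>, \<open>b\<close> demand
  it in both directions.\<close>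

definition sparse_at :: "('a::metric_space \<Rightarrow> real) \<Rightarrow> nat \<Rightarrow> 'a set \<Rightarrow> bool" where
  "sparse_at w n H \<longleftrightarrow> (\<forall>A\<subseteq>H. (\<forall>a\<in>A. \<forall>b\<in>A. a \<noteq> b \<longrightarrow> near w a b) \<longrightarrow> card A \<le> n)"

text \<open>Adding \<open>p\<close> to a maximal sparse \<open>H\<close> creates a clique of more
  than \<open>n\<close> points. It must contain \<open>p\<close>, and its other members, at least
  \<open>n\<close>, are hubs near \<open>p\<close> in both directions.\<close>

lemma maximal_sparse_set:
  assumes "finite S"
  obtains H where "H \<subseteq> S" "sparse_at w n H"
    "\<And>p. p \<in> S - H \<Longrightarrow> \<exists>B\<subseteq>H. card B = n \<and> (\<forall>h\<in>B. near w h p \<and> near w p h)"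
proof -
  let ?F = "{H. H \<subseteq> S \<and> sparse_at w n H}"
  have "finite ?F" "?F \<noteq> {}" using assms by (auto simp: sparse_at_def)
  then obtain H where H: "H \<in> ?F" "\<And>H'. H' \<in> ?F \<Longrightarrow> H \<subseteq> H' \<Longrightarrow> H = H'"
    using finite_has_maximal[of ?F] by meson
  show ?thesis
  proof (rule that[of H])
    fix p assume p: "p \<in> S - H"
    then have "\<not> sparse_at w n (insert p H)" using H by blast
    then obtain A where A: "A \<subseteq> insert p H" "\<forall>a\<in>A. \<forall>b\<in>A. a \<noteq> b \<longrightarrow> near w a b" "card A > n"
      unfolding sparse_at_def by (meson not_le)
    have "p \<in> A"
    proof (rule ccontr)
      assume "p \<notin> A"
      then have "A \<subseteq> H" using A(1) by blast
      then show False using A(2,3) H(1) by (simp add: sparse_at_def leD)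
    qed
    moreover have "finite A" using A(3) card.infinite by force
    ultimately have "card (A - {p}) \<ge> n" using A(3) by simp
    then obtain B where B: "B \<subseteq> A - {p}" "card B = n" using obtain_subset_with_card_n by metis
    have "near w h p \<and> near w p h" if "h \<in> B" for h
    proof -
      have "h \<in> A" "h \<noteq> p" using that B(1) by auto
      then show ?thesis using A(2) \<open>p \<in> A\<close> by simp
    qed
    moreover have "B \<subseteq> H" using A(1) B(1) by blast
    ultimately show "\<exists>B\<subseteq>H. card B = n \<and> (\<forall>h\<in>B. near w h p \<and> near w p h)"
      using B(2) by blast
  qed (use H in auto)
qed

lemma ex_heavy_neighbours:
  "\<exists>m::nat. \<forall>(k::nat) (S::'a::euclidean_space set) w. finite S \<and> (\<forall>p\<in>S. w p \<ge> 0) \<longrightarrow>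
    (\<exists>T. heavy_neighbours w S k m T)"
proof -
  \<comment> \<open>The hubs joined to \<open>p\<close>, translated by \<open>p\<close> and rescaled
    by \<open>w p\<close>, lie in this compact set. The mesh 1/16 fits its lower bound 1/4 for
    weights: if \<open>w p / 4 \<le> w h'\<close>, then an error of \<open>w p / 16\<close> is at
    most \<open>w h' / 4\<close>, which \<open>near\<close> tolerates.\<close>
  let ?K = "cball (0::'a) 6 \<times> {1/4..3::real}"
  have "compact ?K" "(1/16::real) > 0" by (simp_all add: compact_Times)
  then obtain f :: "'a \<times> real \<Rightarrow> 'a \<times> real" and C where C: "finite C" "\<And>x. x \<in> ?K \<Longrightarrow> f x \<in> C"
    "\<And>x y. x \<in> ?K \<Longrightarrow> y \<in> ?K \<Longrightarrow> f x = f y \<Longrightarrow> dist x y < 1/16"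
    by (rule compact_finite_classes) blast
  show ?thesis
  proof (intro exI[of _ "card C"] allI impI)
    fix k :: nat and S :: "'a set" and w :: "'a \<Rightarrow> real"
    assume fin: "finite S \<and> (\<forall>p\<in>S. w p \<ge> 0)"
    \<comment> \<open>Both points of a heavy pair have positive weight, so hubs are sought only
      among such points. Positive hub weights also make \<open>T p\<close> empty when
      \<open>w p\<close> is 0, where rescaling fails.\<close>
    then have "finite {p\<in>S. w p > 0}" by simp
    then obtain H where H: "H \<subseteq> {p\<in>S. w p > 0}" "sparse_at w (k + 1) H"
      "\<And>p. p \<in> {p\<in>S. w p > 0} - H \<Longrightarrow> \<exists>B\<subseteq>H. card B = k + 1 \<and> (\<forall>h\<in>B. near w h p \<and> near w p h)"
      by (rule maximal_sparse_set[of _ w "k + 1"]) blast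
    define T where
      "T p = {h\<in>H. h \<noteq> p \<and> w p / 4 \<le> w h \<and> w h \<le> 3 * w p \<and> dist p h \<le> 6 * w p}" for p
    have card: "card (T p) \<le> card C * (k + 1)" for p
    proof (cases "w p > 0")
      case False
      then have "T p = {}" using H(1) by (force simp: T_def)
      then show ?thesis by simp
    next
      case True
      define g where "g h = ((h - p) /\<^sub>R w p, w h / w p)" for h
      have g: "g h \<in> ?K" if "h \<in> T p" for h
        using that True by (auto simp: g_def T_def dist_norm norm_minus_commute divide_simps mult.commute)
      have near: "near w h h'" if "h \<in> T p" "h' \<in> T p" "f (g h) = f (g h')" for h h'
      proof -
        have "dist (g h) (g h') < 1/16" using that g C(3) by blast
        then have "dist (fst (g h)) (fst (g h')) < 1/16" "dist (snd (g h)) (snd (g h')) < 1/16"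
          using dist_fst_le dist_snd_le le_less_trans by blast+
        moreover have "dist (fst (g h)) (fst (g h')) = dist h h' / w p"
          using True by (simp add: g_def dist_norm flip: scaleR_diff_right) (simp add: divide_inverse_commute)
        moreover have "dist (snd (g h)) (snd (g h')) = \<bar>w h - w h'\<bar> / w p"
          using True by (simp add: g_def dist_real_def flip: diff_divide_distrib)
        ultimately have dist: "dist h h' < w p / 16" and abs: "\<bar>w h - w h'\<bar> < w p / 16"
          using True by (simp_all add: field_simps)
        have "w h - w h' < w p / 16" using abs by linarith
        then show ?thesis using dist that(2) by (simp add: near_def T_def)
      qed
      show ?thesis
      proof (rule card_le_by_classes[OF C(1), of _ "\<lambda>h. f (g h)"])
        fix c
        \<comment> \<open>Hubs of one class are pairwise near, so sparsity allows at most
          \<open>k + 1\<close> of them.\<close>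
        have "{x \<in> T p. f (g x) = c} \<subseteq> H" by (auto simp: T_def)
        then show "card {x \<in> T p. f (g x) = c} \<le> k + 1"
          using H(2) near unfolding sparse_at_def by simp
      qed (use C(2) g in blast)
    qed
    have sub: "T p \<subseteq> S - {p}" for p using H(1) by (auto simp: T_def)
    have step: "q \<in> T p \<or> p \<in> T q \<or>
        (\<exists>B\<subseteq>T p \<inter> T q. card B = k + 1 \<and> (\<forall>h\<in>B. dw w p h + dw w h q \<le> 4 * dw w p q))"
      if pq: "p \<in> S" "q \<in> S" "p \<noteq> q" "5 * w q > 3 * w p + dist p q" "5 * w p > 3 * w q + dist p q"
        "p \<notin> H" for p q
    proof -
      have pos: "w p > 0" "w q > 0" using pq fin zero_le_dist[of p q] by (smt (verit))+
      then obtain B where B: "B \<subseteq> H" "card B = k + 1" "\<forall>h\<in>B. near w h p \<and> near w p h"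
        using H(3)[of p] pq by blast
      have in_p: "h \<in> T p" if "h \<in> B" for h
        using that B pq(6) pos by (auto simp: near_def T_def dist_commute)
      \<comment> \<open>The heavy conditions imply that \<open>w p\<close> lies between
        \<open>3/5 * w q\<close> and \<open>5/3 * w q\<close> and that
        \<open>dist p q < 2 * w q\<close>. A hub near \<open>p\<close> therefore meets the wider
        bounds of \<open>T q\<close>.\<close>
      have in_q: "h \<in> T q" if "h \<in> B" "h \<noteq> q" for h
      proof -
        have "near w h p" "near w p h" "h \<in> H" using that B by auto
        then show ?thesis using that(2) pq(4,5) pos dist_triangle[of q h p]
          by (auto simp: near_def T_def dist_commute) (use zero_le_dist[of p q] in linarith)+
      qed
      \<comment> \<open>The detour costs at most
        \<open>w p + 2 * dist p h + 2 * w h + dist p q + w q\<close>, and nearness bounds the two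
        middle terms for \<open>h\<close> by \<open>(1/2 + 5/2) * w p\<close>. The total is at most
        \<open>4 * w p + dist p q + w q\<close>.\<close>
      have short: "dw w p h + dw w h q \<le> 4 * dw w p q" if "h \<in> B" "h \<noteq> q" for h
      proof -
        have "near w h p" "h \<noteq> p" using that B pq(6) by auto
        then show ?thesis using that(2) pq(3) pos dist_triangle[of h q p]
          by (auto simp: near_def dw_def dist_commute) (use zero_le_dist[of p q] in linarith)
      qed
      show ?thesis
      \<comment> \<open>If \<open>q\<close> is itself one of the hubs near \<open>p\<close>, it
        cannot be the middle of the path, but \<open>p\<close> is joined to it directly.\<close>
      proof (cases "q \<in> B")
        case True
        then show ?thesis using in_p by blast
      next
        case False
        then show ?thesis using B(2) in_p in_q short by (intro disjI2 exI[of _ B]) auto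
      qed
    qed
    have "q \<in> T p \<or> p \<in> T q \<or>
        (\<exists>B\<subseteq>T p \<inter> T q. card B = k + 1 \<and> (\<forall>h\<in>B. dw w p h + dw w h q \<le> 4 * dw w p q))"
      if pq: "p \<in> S" "q \<in> S" "p \<noteq> q" "5 * w q > 3 * w p + dist p q" "5 * w p > 3 * w q + dist p q"
      for p q
    proof -
      consider "p \<in> H" "q \<in> H" | "p \<notin> H" | "q \<notin> H" by blast
      then show ?thesis
      proof cases
        case 1
        have "w p \<ge> 0" "w q \<ge> 0" using pq fin by auto
        then have "q \<in> T p"
          using 1 pq unfolding T_def by (simp, use zero_le_dist[of p q] in linarith)
        then show ?thesis by blast
      next
        case 2
        then show ?thesis using step pq by blast
      next
        case 3
        have "p \<in> T q \<or> q \<in> T p \<or>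
          (\<exists>B\<subseteq>T q \<inter> T p. card B = k + 1 \<and> (\<forall>h\<in>B. dw w q h + dw w h p \<le> 4 * dw w q p))"
          using 3 pq by (intro step) (auto simp: dist_commute)
        then show ?thesis by (metis Int_commute add.commute dw_commute)
      qed
    qed
    then show "\<exists>T. heavy_neighbours w S k (card C) T"
      using sub card unfolding heavy_neighbours_def by (intro exI[of _ T]) simp
  qed
qed

section \<open>Walks of bounded weight and routing\<close>

definition reaches :: "('a::euclidean_space \<Rightarrow> real) \<Rightarrow> 'a set set \<Rightarrow> 'a set \<Rightarrow> 'a \<Rightarrow> 'a \<Rightarrow> real \<Rightarrow> bool" where
  "reaches w E V p q x \<longleftrightarrow> (\<exists>xs. is_walk E V xs \<and> hd xs = p \<and> last xs = q \<and> walk_weight w xs \<le> x)"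

lemma is_walk_Cons_Cons:
  "is_walk E V (x # y # zs) \<longleftrightarrow> x \<in> V \<and> {x, y} \<in> E \<and> is_walk E V (y # zs)"
  by (auto simp: is_walk_def less_Suc_eq_0_disj)

lemma walk_weight_Cons_Cons: "walk_weight w (x # y # zs) = dw w x y + walk_weight w (y # zs)"
  by (simp add: walk_weight_def sum.lessThan_Suc_shift del: sum.lessThan_Suc)

lemma reaches_mono: "reaches w E V p q x \<Longrightarrow> x \<le> y \<Longrightarrow> reaches w E V p q y"
  unfolding reaches_def using order_trans by blast

lemma reaches_refl: "p \<in> V \<Longrightarrow> reaches w E V p p 0"
  unfolding reaches_def by (intro exI[of _ "[p]"]) (simp add: is_walk_def walk_weight_def)

lemma reaches_edge: "p \<in> V \<Longrightarrow> q \<in> V \<Longrightarrow> {p, q} \<in> E \<Longrightarrow> reaches w E V p q (dw w p q)"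
  unfolding reaches_def by (intro exI[of _ "[p, q]"]) (simp add: is_walk_def walk_weight_def)

lemma reaches_trans:
  assumes "reaches w E V p r x" "reaches w E V r q y"
  shows "reaches w E V p q (x + y)"
proof -
  obtain ys where ys: "is_walk E V ys" "hd ys = r" "last ys = q" "walk_weight w ys \<le> y"
    using assms(2) unfolding reaches_def by blast
  have "\<exists>zs. is_walk E V zs \<and> hd zs = hd xs \<and> last zs = q \<and> walk_weight w zs \<le> walk_weight w xs + y"
    if "is_walk E V xs" "last xs = r" for xs
    using that
  proof (induction xs rule: induct_list012)
    case 1
    then show ?case by (simp add: is_walk_def)
  next
    case (2 a)
    then show ?case using ys by (intro exI[of _ ys]) (simp add: walk_weight_def)
  next
    case (3 a b cs)
    then obtain zs where zs: "is_walk E V zs" "hd zs = b" "last zs = q"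
      "walk_weight w zs \<le> walk_weight w (b # cs) + y"
      by (auto simp: is_walk_Cons_Cons)
    then obtain zs' where "zs = b # zs'" by (cases zs) (auto simp: is_walk_def)
    then show ?case using zs 3(3)
      by (intro exI[of _ "a # zs"]) (auto simp: is_walk_Cons_Cons walk_weight_Cons_Cons)
  qed
  then show ?thesis using assms(1) unfolding reaches_def by (smt (verit))
qed

lemma ex_surviving:
  assumes "card B = k + 1" "finite F" "card F \<le> k"
  obtains r where "r \<in> B" "r \<notin> F"
  using assms card_mono[of F B] by fastforce

text \<open>Induction on the rank of \<open>dw w p q\<close> among the finitely many pairs of
  \<open>V\<close>. An edge to \<open>r \<noteq> p\<close> has positive weight, so the budget left
  for \<open>r\<close> and \<open>q\<close> forces a strictly smaller distance. The last two
  alternatives let the walk grow from either end.\<close>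

lemma reaches_all:
  assumes "finite V" and nonneg: "\<And>p. p \<in> V \<Longrightarrow> w p \<ge> 0"
    and step: "\<And>p q. p \<in> V \<Longrightarrow> q \<in> V \<Longrightarrow> p \<noteq> q \<Longrightarrow>
      reaches w E V p q (t * dw w p q) \<or>
      (\<exists>r\<in>V. r \<noteq> p \<and> {p, r} \<in> E \<and> dw w p r + t * dw w r q \<le> t * dw w p q) \<or>
      (\<exists>r\<in>V. r \<noteq> q \<and> {q, r} \<in> E \<and> dw w q r + t * dw w r p \<le> t * dw w q p)"
    and "t > 0" "p \<in> V" "q \<in> V"
  shows "reaches w E V p q (t * dw w p q)"
  using assms(5,6)
proof (induction "card {(a, b). a \<in> V \<and> b \<in> V \<and> dw w a b < dw w p q}"
    arbitrary: p q rule: less_induct)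
  case less
  have smaller: "reaches w E V a b (t * dw w a b)"
    if ab: "a \<in> V" "b \<in> V" "dw w a b < dw w p q" for a b
  proof (rule less.hyps[OF _ ab(1,2)])
    \<comment> \<open>The inclusion is strict because \<open>(a, b)\<close> itself belongs only to
      the larger set.\<close>
    have "{(x, y). x \<in> V \<and> y \<in> V \<and> dw w x y < dw w a b}
      \<subset> {(x, y). x \<in> V \<and> y \<in> V \<and> dw w x y < dw w p q}"
      using ab by auto
    moreover have "finite {(x, y). x \<in> V \<and> y \<in> V \<and> dw w x y < dw w p q}"
      by (rule finite_subset[of _ "V \<times> V"]) (use assms(1) in auto)
    ultimately show "card {(x, y). x \<in> V \<and> y \<in> V \<and> dw w x y < dw w a b}
      < card {(x, y). x \<in> V \<and> y \<in> V \<and> dw w x y < dw w p q}"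
      by (rule psubset_card_mono[rotated])
  qed
  have decr: "dw w r b < dw w a b"
    if "a \<in> V" "r \<in> V" "r \<noteq> a" "dw w a r + t * dw w r b \<le> t * dw w a b" for a r b
  proof -
    have "dw w a r > 0" using that nonneg[of a] nonneg[of r] zero_less_dist_iff[of a r]
      unfolding dw_def by (smt (verit))
    then have "t * dw w r b < t * dw w a b" using that by linarith
    then show ?thesis using \<open>t > 0\<close> by simp
  qed
  show ?case
  proof (cases "p = q")
    case True
    then show ?thesis using reaches_refl less.prems by (simp add: dw_def)
  next
    case False
    from step[OF less.prems False] consider
      "reaches w E V p q (t * dw w p q)"
      | r where "r \<in> V" "r \<noteq> p" "{p, r} \<in> E" "dw w p r + t * dw w r q \<le> t * dw w p q"
      | r where "r \<in> V" "r \<noteq> q" "{q, r} \<in> E" "dw w q r + t * dw w r p \<le> t * dw w q p"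
      by blast
    then show ?thesis
    proof cases
      case 1
      then show ?thesis .
    next
      case 2
      have "reaches w E V p q (dw w p r + t * dw w r q)"
        using 2 less.prems decr[of p r q] by (intro reaches_trans[OF reaches_edge smaller]) auto
      then show ?thesis using reaches_mono 2 by blast
    next
      case 3
      have "reaches w E V p q (t * dw w p r + dw w r q)"
        using 3 less.prems decr[of q r p]
        by (intro reaches_trans[OF smaller reaches_edge]) (auto simp: dw_commute insert_commute)
      then show ?thesis using reaches_mono 3 by (metis add.commute dw_commute)
    qed
  qed
qed

section \<open>Union of the two graphs: fault tolerance and edge count\<close>

theorem theorem1:
  fixes \<epsilon> :: real
  assumes "\<epsilon> > 0"
  shows "\<exists>C::real. \<forall>k::nat. \<forall>S :: ('a::euclidean_space) set. \<forall>w :: 'a \<Rightarrow> real.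
           k \<ge> 1 \<and> finite S \<and> (\<forall>p\<in>S. w p \<ge> 0) \<longrightarrow>
           (\<exists>E. is_VFTAWS w S E k (4 + \<epsilon>) \<and> real (card E) \<le> C * real k * real (card S))"
proof -
  obtain m1 :: nat where m1: "\<And>k (S::'a set) w. finite S \<Longrightarrow> \<exists>T. light_neighbours w S k m1 T"
    using ex_light_neighbours by blast
  obtain m2 :: nat where m2: "\<And>k (S::'a set) w. finite S \<and> (\<forall>p\<in>S. w p \<ge> 0) \<Longrightarrow>
      \<exists>T. heavy_neighbours w S k m2 T"
    using ex_heavy_neighbours by blast
  show ?thesis
  proof (intro exI[of _ "2 * (real m1 + real m2)"] allI impI, elim conjE)
    fix k :: nat and S :: "'a set" and w :: "'a \<Rightarrow> real"
    assume k: "k \<ge> 1" and fin: "finite S" and nonneg: "\<forall>p\<in>S. w p \<ge> 0"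
    obtain T1 where "light_neighbours w S k m1 T1" using m1 fin by blast
    then have T1: "\<And>p. p \<in> S \<Longrightarrow> T1 p \<subseteq> S - {p}" "\<And>p. p \<in> S \<Longrightarrow> card (T1 p) \<le> m1 * (k + 1)"
      "\<And>p q. p \<in> S \<Longrightarrow> q \<in> S \<Longrightarrow> p \<noteq> q \<Longrightarrow> 5 * w q \<le> 3 * w p + dist p q \<Longrightarrow> q \<notin> T1 p \<Longrightarrow>
        \<exists>B\<subseteq>T1 p. card B = k + 1 \<and> (\<forall>r\<in>B. dw w p r + 4 * dw w r q \<le> 4 * dw w p q)"
      unfolding light_neighbours_def by auto
    obtain T2 where "heavy_neighbours w S k m2 T2" using m2 fin nonneg by blast
    then have T2: "\<And>p. p \<in> S \<Longrightarrow> T2 p \<subseteq> S - {p}" "\<And>p. p \<in> S \<Longrightarrow> card (T2 p) \<le> m2 * (k + 1)"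
      "\<And>p q. p \<in> S \<Longrightarrow> q \<in> S \<Longrightarrow> p \<noteq> q \<Longrightarrow> 5 * w q > 3 * w p + dist p q \<Longrightarrow>
        5 * w p > 3 * w q + dist p q \<Longrightarrow> q \<in> T2 p \<or> p \<in> T2 q \<or>
          (\<exists>B\<subseteq>T2 p \<inter> T2 q. card B = k + 1 \<and> (\<forall>h\<in>B. dw w p h + dw w h q \<le> 4 * dw w p q))"
      unfolding heavy_neighbours_def by blast+
    define T where "T p = T1 p \<union> T2 p" for p
    define E where "E = (\<Union>p\<in>S. (\<lambda>r. {p, r}) ` T p)"
    have sub: "T p \<subseteq> S - {p}" if "p \<in> S" for p using T1(1) T2(1) that by (simp add: T_def)
    have edge: "{p, r} \<in> E" "{r, p} \<in> E" if "p \<in> S" "r \<in> T p" for p r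
      using that by (auto simp: E_def insert_commute)
    have spanner: "is_spanner w E (S - F) (4 + \<epsilon>)" if F: "finite F" "card F \<le> k" for F
      unfolding is_spanner_def
    proof (intro ballI)
      fix p q assume pq: "p \<in> S - F" "q \<in> S - F"
      \<comment> \<open>If \<open>b\<close> was not chosen in its cone, \<open>k + 1\<close>
        candidates replace it as the next vertex, and at most \<open>k\<close> of them are
        deleted.\<close>
      have light: "{a, b} \<in> E \<or>
          (\<exists>r\<in>S - F. r \<noteq> a \<and> {a, r} \<in> E \<and> dw w a r + 4 * dw w r b \<le> 4 * dw w a b)"
        if ab: "a \<in> S - F" "b \<in> S - F" "a \<noteq> b" "5 * w b \<le> 3 * w a + dist a b" for a b
      proof (cases "b \<in> T1 a")
        case True
        then show ?thesis using ab edge[of a b] by (simp add: T_def)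
      next
        case False
        then obtain B where B: "B \<subseteq> T1 a" "card B = k + 1"
          "\<forall>r\<in>B. dw w a r + 4 * dw w r b \<le> 4 * dw w a b"
          using T1(3)[of a b] ab by auto
        obtain r where "r \<in> B" "r \<notin> F" using ex_surviving B(2) F by blast
        then show ?thesis using B T1(1)[of a] ab edge[of a r]
          by (intro disjI2 bexI[of _ r]) (auto simp: T_def)
      qed
      have direct: "reaches w E (S - F) a b (4 * dw w a b)"
        if ab: "a \<in> S - F" "b \<in> S - F" "{a, b} \<in> E" for a b
      proof (rule reaches_mono[OF reaches_edge[OF ab]])
        have "dw w a b \<ge> 0" using ab nonneg by (simp add: dw_def)
        then show "dw w a b \<le> 4 * dw w a b" by simp
      qed
      have "reaches w E (S - F) p q (4 * dw w p q)"
      proof (rule reaches_all)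
        fix a b assume ab: "a \<in> S - F" "b \<in> S - F" "a \<noteq> b"
        \<comment> \<open>Either \<open>b\<close> is light for \<open>a\<close>, or \<open>a\<close>
          is light for \<open>b\<close> and the walk is extended at the end \<open>b\<close>, or the
          pair is heavy.\<close>
        consider "5 * w b \<le> 3 * w a + dist a b" | "5 * w a \<le> 3 * w b + dist b a"
          | "5 * w b > 3 * w a + dist a b" "5 * w a > 3 * w b + dist a b"
          by (metis dist_commute not_le)
        then show "reaches w E (S - F) a b (4 * dw w a b) \<or>
          (\<exists>r\<in>S - F. r \<noteq> a \<and> {a, r} \<in> E \<and> dw w a r + 4 * dw w r b \<le> 4 * dw w a b) \<or>
          (\<exists>r\<in>S - F. r \<noteq> b \<and> {b, r} \<in> E \<and> dw w b r + 4 * dw w r a \<le> 4 * dw w b a)"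
        proof cases
          case 1
          then show ?thesis using light[of a b] direct ab by blast
        next
          case 2
          then show ?thesis using light[of b a] direct[of a b] ab by (auto simp: insert_commute)
        next
          case 3
          then consider "{a, b} \<in> E" | B where "B \<subseteq> T2 a \<inter> T2 b" "card B = k + 1"
            "\<forall>h\<in>B. dw w a h + dw w h b \<le> 4 * dw w a b"
            using T2(3)[of a b] ab edge[of a b] edge[of b a] by (auto simp: T_def)
          then show ?thesis
          proof cases
            case 1
            then show ?thesis using direct ab by blast
          next
            case 2
            \<comment> \<open>A surviving hub is joined to both ends, so the heavy case is settled
              by a complete walk, without recursion.\<close>
            obtain h where h: "h \<in> B" "h \<notin> F" using ex_surviving 2(2) F by blast
            then have "h \<in> S - F" "{a, h} \<in> E" "{h, b} \<in> E"
              using 2(1) T2(1)[of a] ab edge[of a h] edge[of b h] by (auto simp: T_def)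
            then have "reaches w E (S - F) a b (dw w a h + dw w h b)"
              using ab by (intro reaches_trans[OF reaches_edge reaches_edge])
            then show ?thesis using reaches_mono 2(3) h by blast
          qed
        qed
      qed (use pq fin nonneg in auto)
      moreover have "dw w p q \<ge> 0" using pq nonneg by (simp add: dw_def)
      then have "4 * dw w p q \<le> (4 + \<epsilon>) * dw w p q" using assms by (intro mult_right_mono) auto
      ultimately show "\<exists>xs. is_walk E (S - F) xs \<and> hd xs = p \<and> last xs = q \<and>
          walk_weight w xs \<le> (4 + \<epsilon>) * dw w p q"
        using reaches_mono unfolding reaches_def by blast
    qed
    have "is_VFTAWS w S E k (4 + \<epsilon>)"
      unfolding is_VFTAWS_def using spanner sub by (auto simp: E_def) blast
    moreover have "real (card E) \<le> 2 * (real m1 + real m2) * real k * real (card S)"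
    proof -
      have "card ((\<lambda>r. {p, r}) ` T p) \<le> 2 * (m1 + m2) * k" if "p \<in> S" for p
      proof -
        have "finite (T p)" using sub[OF that] fin finite_subset by blast
        then have "card ((\<lambda>r. {p, r}) ` T p) \<le> card (T p)" by (rule card_image_le)
        also have "\<dots> \<le> (m1 + m2) * (k + 1)"
          unfolding T_def using card_Un_le[of "T1 p" "T2 p"] T1(2)[OF that] T2(2)[OF that]
          by (simp add: algebra_simps)
        \<comment> \<open>Here \<open>k + 1 \<le> 2 * k\<close> turns the bound into a multiple of
          \<open>k\<close>; this is the factor 2 in the constant.\<close>
        also have "\<dots> \<le> (m1 + m2) * (2 * k)" using k by (intro mult_le_mono2) simp
        finally show ?thesis by (simp add: algebra_simps)
      qed
      then have "card E \<le> card S * (2 * (m1 + m2) * k)"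
        unfolding E_def by (rule card_UN_bounded[OF fin])
      then have "real (card E) \<le> real (card S * (2 * (m1 + m2) * k))" by (simp only: of_nat_le_iff)
      then show ?thesis by (simp add: algebra_simps)
    qed
    ultimately show "\<exists>E. is_VFTAWS w S E k (4 + \<epsilon>) \<and>
        real (card E) \<le> 2 * (real m1 + real m2) * real k * real (card S)"
      by blast
  qed
qed

end
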